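(* Assume that for each $i\in\{1,2\}$ there is $\theta_i\in(0,K_i)$ such that $f_i(0)=f_i(\theta_i)=f_i(K_i)=0$, $f_i'(0)<0$, $f_i'(\theta_i)>0$, $f_i'(K_i)<0$, $f_i<0$ in $(0,\theta_i)\cup(K_i,+\infty)$, $f_i>0$ in $(-\infty,0)\cup(\theta_i,K_i)$. Assume moreover that $\int_0^{K_i}f_i(s)\,\mathrm{d}s<0$ for $i=1,2$ (equivalently, the traveling front speeds $c_i$ are negative). Then, for any nonnegative continuous and compactly supported initial datum $u_0$, the solution $u$ of (P) goes to extinction, that is, $\|u(t,\cdot)\|_{L^\infty(\mathbb{R})}\to0$ as $t\to+\infty$.
   Context: Setting. Let $d_1,d_2,\sigma>0$ and let $f_1,f_2\in C^1(\mathbb{R})$, with constants $K_1,K_2>0$. Put $I_1=(-\infty,0)$ (patch 1), $I_2=(0,+\infty)$ (patch 2). Problem (P) is $$\begin{cases}u_t=d_1u_{xx}+f_1(u),& t>0,\ x<0,\\ u_t=d_2u_{xx}+f_2(u),& t>0,\ x>0,\\ u(t,0^-)=u(t,0^+),& t>0,\\ u_x(t,0^-)=\sigma u_x(t,0^+),& t>0,\end{cases}$$ with initial condition $u(0,\cdot)=u_0$. A classical solution is a continuous $u:[0,+\infty)\times\mathbb{R}\to\mathbb{R}$ with $u(0,\cdot)=u_0$, such that for $i=1,2$ the restriction of $u$ to $(0,+\infty)\times\overline{I_i}$ is $C^1$ in $t$ and $C^2$ in $x$ (up to $x=0$), and all identities in (P) hold pointwise. For every nonnegative bounded continuous $u_0$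 there is a unique nonnegative bounded classical solution, called the solution of (P) with initial datum $u_0$. The front speed $c_i$ is the unique real number for which there is $\phi_i:\mathbb{R}\to(0,K_i)$ with $d_i\phi_i''+c_i\phi_i'+f_i(\phi_i)=0$, $\phi_i'<0$ in $\mathbb{R}$, $\phi_i(-\infty)=K_i$, $\phi_i(+\infty)=0$; it has the sign of $\int_0^{K_i}f_i(s)\,\mathrm{d}s$. *)

theory Defs
  imports "HOL-Analysis.Analysis" "HOL-Probability.Essential_Supremum"
begin

text \<open>Bistable nonlinearity with stable zeros 0, K and intermediate unstable zero \<open>\<theta>\<close>.\<close>

definition bistable :: "(real \<Rightarrow> real) \<Rightarrow> real \<Rightarrow> real \<Rightarrow> bool" where
  "bistable f \<theta> K \<longleftrightarrow>
     0 < \<theta> \<and> \<theta> < K \<and>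
     f 0 = 0 \<and> f \<theta> = 0 \<and> f K = 0 \<and>
     deriv f 0 < 0 \<and> deriv f \<theta> > 0 \<and> deriv f K < 0 \<and>
     (\<forall>s \<in> {0<..<\<theta>} \<union> {K<..}. f s < 0) \<and>
     (\<forall>s \<in> {..<0} \<union> {\<theta><..<K}. f s > 0)"

text \<open>
  \<open>C12_derivs S u ut ux uxx\<close>: on the set of (t, x) with t > 0 and x in S, the function u is of
  class \<open>C\<^sup>1\<close> in t and \<open>C\<^sup>2\<close> in x, with (jointly continuous) derivatives ut, ux, uxx. Derivatives
  in x are relative to S, hence one-sided at an end point of S. When S is a nondegenerate
  interval, ut, ux, uxx are uniquely determined by u for t > 0 and x in S.
\<close>

definition C12_derivs ::
  "real set \<Rightarrow> (real \<Rightarrow> real \<Rightarrow> real) \<Rightarrow> (real \<Rightarrow> real \<Rightarrow> real) \<Rightarrow>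
   (real \<Rightarrow> real \<Rightarrow> real) \<Rightarrow> (real \<Rightarrow> real \<Rightarrow> real) \<Rightarrow> bool" where
  "C12_derivs S u ut ux uxx \<longleftrightarrow>
     (\<forall>t>0. \<forall>x\<in>S.
        ((\<lambda>s. u s x) has_real_derivative ut t x) (at t) \<and>
        ((\<lambda>y. u t y) has_real_derivative ux t x) (at x within S) \<and>
        ((\<lambda>y. ux t y) has_real_derivative uxx t x) (at x within S)) \<and>
     continuous_on ({0<..} \<times> S) (\<lambda>(t, x). ut t x) \<and>
     continuous_on ({0<..} \<times> S) (\<lambda>(t, x). ux t x) \<and>
     continuous_on ({0<..} \<times> S) (\<lambda>(t, x). uxx t x)"

text \<open>
  Classical solutions of the two-patch problem. Only the values u t x with \<open>t \<ge> 0\<close> matter.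
  The matching condition \<open>u(t,0-) = u(t,0+)\<close> is part of the continuity of u on
  \<open>[0,\<infinity>) \<times> \<real>\<close>; the values \<open>ux1 t 0\<close> and \<open>ux2 t 0\<close> are \<open>u\<^sub>x(t,0-)\<close> and \<open>u\<^sub>x(t,0+)\<close>.
\<close>

definition classical_solution ::
  "real \<Rightarrow> real \<Rightarrow> real \<Rightarrow> (real \<Rightarrow> real) \<Rightarrow> (real \<Rightarrow> real) \<Rightarrow>
   (real \<Rightarrow> real) \<Rightarrow> (real \<Rightarrow> real \<Rightarrow> real) \<Rightarrow> bool" where
  "classical_solution d1 d2 \<sigma> f1 f2 u0 u \<longleftrightarrow>
     continuous_on ({0..} \<times> UNIV) (\<lambda>(t, x). u t x) \<and>
     (\<forall>x. u 0 x = u0 x) \<and>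
     (\<exists>ut1 ux1 uxx1 ut2 ux2 uxx2.
        C12_derivs {..0} u ut1 ux1 uxx1 \<and>
        C12_derivs {0..} u ut2 ux2 uxx2 \<and>
        (\<forall>t>0. \<forall>x<0. ut1 t x = d1 * uxx1 t x + f1 (u t x)) \<and>
        (\<forall>t>0. \<forall>x>0. ut2 t x = d2 * uxx2 t x + f2 (u t x)) \<and>
        (\<forall>t>0. ux1 t 0 = \<sigma> * ux2 t 0))"

definition nonneg_bounded_classical_solution ::
  "real \<Rightarrow> real \<Rightarrow> real \<Rightarrow> (real \<Rightarrow> real) \<Rightarrow> (real \<Rightarrow> real) \<Rightarrow>
   (real \<Rightarrow> real) \<Rightarrow> (real \<Rightarrow> real \<Rightarrow> real) \<Rightarrow> bool" where
  "nonneg_bounded_classical_solution d1 d2 \<sigma> f1 f2 u0 u \<longleftrightarrow>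
     classical_solution d1 d2 \<sigma> f1 f2 u0 u \<and>
     (\<forall>t\<ge>0. \<forall>x. 0 \<le> u t x) \<and>
     (\<exists>M. \<forall>t\<ge>0. \<forall>x. \<bar>u t x\<bar> \<le> M)"

definition Linf_norm :: "(real \<Rightarrow> real) \<Rightarrow> ereal" where
  "Linf_norm g = esssup lborel (\<lambda>x. ereal \<bar>g x\<bar>)"

definition extinction :: "(real \<Rightarrow> real \<Rightarrow> real) \<Rightarrow> bool" where
  "extinction u \<longleftrightarrow> ((\<lambda>t. Linf_norm (\<lambda>x. u t x)) \<longlongrightarrow> 0) at_top"

end

theory Submission
  imports Defs "HOL-Real_Asymp.Real_Asymp"
begin

text \<open>
  An increasing profile in the first patch and a decreasing one in the second, joined to a tent whose
  peak sits at the interface, give a barrier that sinks to zero.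

  Consider one patch. In the phase plane of \<open>d V'' + f(V) = 0\<close>, the orbit of zero energy satisfies
  \<open>d V'\<^sup>2 = - 2 \<integral>\<^sub>0\<^sup>V f\<close>. As the nonlinearity is bistable and its integral over \<open>[0,K]\<close> is negative, the
  right-hand side is positive for every \<open>V > 0\<close> (\<open>bistable_potential_negative\<close>), even with a
  quadratic margin (\<open>bistable_potential_quadratic\<close>). So this orbit is a profile that increases from
  \<open>0\<close> at \<open>-\<infinity>\<close> past every height. The margin allows a slightly flatter profile with
  \<open>d V'' + f(V) = - k V\<close>, and the surplus \<open>k V\<close> leaves room to slide the profile to the right
  while it remains a supersolution (\<open>bistable_retreating_profile\<close>).

  On \<open>x \<le> 0\<close> take the profile of the first patch, on \<open>x \<ge> 0\<close> the mirror image of the profile of the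
  second patch, both placed so that they have height \<open>exp (l - e t)\<close> at \<open>x = 0\<close>. The resulting tent
  increases up to the interface and decreases after it; such a kink is a strict supersolution for
  \<open>u\<^sub>x(t,0-) = \<sigma> u\<^sub>x(t,0+)\<close> for every \<open>\<sigma> > 0\<close>, whatever the two nonlinearities are.
  For large \<open>l\<close> the tent lies above the compactly supported initial datum
  (\<open>retreating_profile_large\<close>). A maximum principle on the whole line, with a quadratically growing
  perturbation to exclude contact at infinity, keeps the solution below the tent
  (\<open>classical_solution_below_barrier\<close>). The tent is highest at its peak, so
  \<open>0 \<le> u(t,x) \<le> exp (l - e t)\<close>, and the solution goes to extinction exponentially fast.
\<close>

section \<open>Derivatives at a maximum and first contact\<close>

lemma second_derivative_nonpos_at_local_max:
  fixes g g' :: "real \<Rightarrow> real"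
  assumes "e > 0"
    and g: "\<And>y. \<bar>y - x\<bar> < e \<Longrightarrow> (g has_real_derivative g' y) (at y)"
    and g': "(g' has_real_derivative g2) (at x)"
    and max: "\<And>y. \<bar>y - x\<bar> < e \<Longrightarrow> g y \<le> g x"
  shows "g2 \<le> 0"
proof (rule ccontr)
  assume "\<not> g2 \<le> 0"
  have "g' x = 0"
    using DERIV_local_max[of g "g' x" x e] g[of x] max \<open>e > 0\<close> by (auto simp: abs_minus_commute)
  moreover obtain r where r: "r > 0" "\<And>h. 0 < h \<Longrightarrow> h < r \<Longrightarrow> g' x < g' (x + h)"
    using DERIV_pos_inc_right[OF g'] \<open>\<not> g2 \<le> 0\<close> by auto
  define h where "h = min r e / 2"
  have h: "0 < h" "h < r" "h < e"
    using \<open>r > 0\<close> \<open>e > 0\<close> by (auto simp: h_def)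
  obtain y where y: "x < y" "y < x + h" "g (x + h) - g x = (x + h - x) * g' y"
    using MVT2[of x "x + h" g g'] g h by auto
  ultimately have "g' y > 0"
    using r(2)[of "y - x"] h by auto
  then have "g (x + h) > g x"
    using y h by (simp add: algebra_simps)
  then show False
    using max[of "x + h"] h by auto
qed

lemma derivative_nonneg_at_left_max:
  fixes g :: "real \<Rightarrow> real"
  assumes "(g has_real_derivative D) (at x within {..x})" "a < x" "\<And>y. a \<le> y \<Longrightarrow> y < x \<Longrightarrow> g y \<le> g x"
  shows "D \<ge> 0"
proof (rule ccontr)
  assume "\<not> D \<ge> 0"
  then obtain r where r: "r > 0" "\<forall>h>0. x - h \<in> {..x} \<longrightarrow> h < r \<longrightarrow> g x < g (x - h)"
    using has_real_derivative_neg_dec_left[OF assms(1)] by auto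
  define h where "h = min r (x - a) / 2"
  have "0 < h" "h < r" "h < x - a" using \<open>r > 0\<close> \<open>a < x\<close> by (auto simp: h_def min_def)
  then show False using r(2) assms(3)[of "x - h"] by force
qed

lemma derivative_nonpos_at_right_max:
  fixes g :: "real \<Rightarrow> real"
  assumes "(g has_real_derivative D) (at x within {x..})" "\<And>y. x < y \<Longrightarrow> g y \<le> g x"
  shows "D \<le> 0"
proof (rule ccontr)
  assume "\<not> D \<le> 0"
  then obtain r where r: "r > 0" "\<forall>h>0. x + h \<in> {x..} \<longrightarrow> h < r \<longrightarrow> g x < g (x + h)"
    using has_real_derivative_pos_inc_right[OF assms(1)] by auto
  then show False using assms(2)[of "x + r / 2"] by (auto dest!: spec[of _ "r / 2"])
qed

text \<open>
  Among the points with \<open>z \<ge> 0\<close> there is one with the least time, because the condition \<open>far\<close>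
  confines those up to the time \<open>t1\<close> to a compact set. At that time \<open>z\<close> has a global
  maximum in \<open>x\<close>, and it was negative before: these are the hypotheses of the maximum principle.
\<close>

lemma first_contact:
  fixes z :: "real \<Rightarrow> real \<Rightarrow> real"
  assumes cont: "continuous_on ({0..} \<times> UNIV) (\<lambda>(t, x). z t x)"
    and init: "\<And>x. z 0 x < 0"
    and far: "\<And>t x. 0 \<le> t \<Longrightarrow> \<bar>x\<bar> > R \<Longrightarrow> z t x < 0"
    and "t1 \<ge> 0" "z t1 x1 \<ge> 0"
  obtains t0 x0 where "t0 > 0" "z t0 x0 = 0" "\<And>x. z t0 x \<le> 0"
    "\<And>t x. 0 \<le> t \<Longrightarrow> t < t0 \<Longrightarrow> z t x < 0"
proof -
  define S where "S = {q \<in> {0..t1} \<times> {-R..R}. 0 \<le> (case q of (t, x) \<Rightarrow> z t x)}"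
  have cont': "continuous_on ({0..t1} \<times> {-R..R}) (\<lambda>(t, x). z t x)"
    by (rule continuous_on_subset[OF cont]) auto
  have "compact S"
  proof -
    have "closed S"
      unfolding S_def
      by (rule continuous_on_closed_Collect_le[OF continuous_on_const cont']) (auto intro: closed_Times)
    moreover have "S \<subseteq> {0..t1} \<times> {-R..R}"
      by (auto simp: S_def)
    ultimately show ?thesis
      using compact_Times[of "{0..t1}" "{-R..R}"] by (metis compact_Icc compact_Int_closed inf.absorb2)
  qed
  then have "compact (fst ` S)"
    by (intro compact_continuous_image continuous_intros)
  moreover have "(t1, x1) \<in> S"
    using assms(4,5) far[of t1 x1] by (auto simp: S_def abs_le_iff not_less) (smt (verit))+
  ultimately obtain t0 where t0: "t0 \<in> fst ` S" "\<And>t. t \<in> fst ` S \<Longrightarrow> t0 \<le> t"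
    using compact_attains_inf[of "fst ` S"] by blast
  then obtain x0 where x0: "(t0, x0) \<in> S" by auto
  then have *: "0 \<le> t0" "t0 \<le> t1" "0 \<le> z t0 x0" by (auto simp: S_def)
  have before: "z t x < 0" if "0 \<le> t" "t < t0" for t x
  proof (rule ccontr)
    assume "\<not> z t x < 0"
    then have "(t, x) \<in> S"
      using that * far[of t x] by (auto simp: S_def abs_le_iff not_less) (smt (verit))+
    then show False
      using t0(2)[of t] that by force
  qed
  have "t0 > 0"
    using * init[of x0] by (cases "t0 = 0") auto
  have now: "z t0 x \<le> 0" for x
  proof -
    have "continuous_on {0..t0} (\<lambda>t. (\<lambda>(t, x). z t x) (t, x))"
      by (rule continuous_on_compose2[OF cont]) (auto intro!: continuous_intros)
    then have c: "continuous (at t0 within {0..t0}) (\<lambda>t. z t x)"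
      using \<open>t0 > 0\<close> by (auto simp: continuous_on_eq_continuous_within)
    have "(at_left t0) = (at t0 within {0..t0})"
      using \<open>t0 > 0\<close> by (simp add: at_within_Icc_at_left)
    then have "((\<lambda>t. z t x) \<longlongrightarrow> z t0 x) (at_left t0)"
      using c by (simp add: continuous_within)
    moreover have "eventually (\<lambda>t. z t x \<le> 0) (at_left t0)"
      using eventually_at_left_real[OF \<open>t0 > 0\<close>] by eventually_elim (auto intro: less_imp_le before)
    ultimately show ?thesis
      by (rule tendsto_upperbound) simp
  qed
  show ?thesis
    using that[OF \<open>t0 > 0\<close>, of x0] now before *(3) by (metis order_antisym)
qed

section \<open>The potential of a bistable nonlinearity with negative mass\<close>

lemma C1_lipschitz_on_Icc:
  fixes f :: "real \<Rightarrow> real"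
  assumes "f C1_differentiable_on UNIV"
  obtains L where "L > 0" "\<And>x y. x \<in> {a..b} \<Longrightarrow> y \<in> {a..b} \<Longrightarrow> \<bar>f x - f y\<bar> \<le> L * \<bar>x - y\<bar>"
proof -
  obtain D where D: "\<And>x. (f has_real_derivative D x) (at x)" "continuous_on UNIV D"
    using assms by (auto simp: C1_differentiable_on_def has_real_derivative_iff_has_vector_derivative)
  have "compact (D ` {a..b})"
    by (intro compact_continuous_image continuous_on_subset[OF D(2)]) auto
  then obtain B where B: "B > 0" "\<And>x. x \<in> {a..b} \<Longrightarrow> \<bar>D x\<bar> \<le> B"
    using compact_imp_bounded bounded_pos by (metis imageI real_norm_def)
  have "norm (f x - f y) \<le> B * norm (x - y)" if "x \<in> {a..b}" "y \<in> {a..b}" for x y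
    by (rule field_differentiable_bound[of "{a..b}" f D])
      (use B that D(1) in \<open>auto intro: has_field_derivative_at_within\<close>)
  then show ?thesis using that B(1) by simp
qed

lemma potential_has_derivative:
  fixes f :: "real \<Rightarrow> real"
  assumes "continuous_on UNIV f" "v > 0"
  shows "((\<lambda>v. integral {0..v} f) has_real_derivative f v) (at v)"
proof -
  have "((\<lambda>v. integral {0..v} f) has_real_derivative f v) (at v within {0..v + 1})"
    using assms by (intro integral_has_real_derivative) (auto intro: continuous_on_subset)
  moreover have "at v within {0..v + 1} = at v"
    using assms by (intro at_within_interior) auto
  ultimately show ?thesis by simp
qed

lemma potential_continuous_on:
  fixes f :: "real \<Rightarrow> real"
  assumes "continuous_on UNIV f"
  shows "continuous_on {0..b} (\<lambda>v. integral {0..v} f)"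
  using assms by (intro indefinite_integral_continuous_1 integrable_continuous_real)
    (auto intro: continuous_on_subset)

lemma potential_mean_value:
  fixes f :: "real \<Rightarrow> real"
  assumes "continuous_on UNIV f" "0 \<le> a" "a < b"
  obtains s where "a < s" "s < b" "integral {0..b} f - integral {0..a} f = (b - a) * f s"
proof -
  have "continuous_on {a..b} (\<lambda>v. integral {0..v} f)"
    using assms by (intro continuous_on_subset[OF potential_continuous_on[of f b]]) auto
  moreover have "((\<lambda>v. integral {0..v} f) has_derivative (*) (f s)) (at s)" if "a < s" for s
    using potential_has_derivative[OF assms(1), of s] that assms(2)
    by (simp add: has_field_derivative_def)
  ultimately obtain s where "a < s" "s < b" "integral {0..b} f - integral {0..a} f = f s * (b - a)"
    using mvt[OF \<open>a < b\<close>, of "\<lambda>v. integral {0..v} f" "\<lambda>s. (*) (f s)"] by metis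
  then show ?thesis using that by (simp add: mult.commute)
qed

text \<open>
  The potential \<open>v \<mapsto> \<integral>\<^sub>0\<^sup>v f\<close> decreases on \<open>[0,\<theta>]\<close>, increases on \<open>[\<theta>,K]\<close> and decreases again from \<open>K\<close>
  on. It starts from \<open>0\<close> downwards, and after \<open>\<theta>\<close> it never exceeds its value at \<open>K\<close>, which is negative
  by hypothesis.
\<close>

lemma bistable_potential_negative:
  fixes f :: "real \<Rightarrow> real"
  assumes cont: "continuous_on UNIV f" and f: "bistable f \<theta> K"
    and neg: "integral {0..K} f < 0" and "v > 0"
  shows "integral {0..v} f < 0"
proof -
  consider "v \<le> \<theta>" | "\<theta> < v" "v < K" | "v = K" | "v > K" by linarith
  then show ?thesis
  proof cases
    case 1
    then obtain s where "0 < s" "s < v" "integral {0..v} f - integral {0..0} f = (v - 0) * f s"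
      using potential_mean_value[OF cont, of 0 v] \<open>v > 0\<close> by auto
    moreover have "f s < 0"
      using f 1 calculation unfolding bistable_def by auto
    ultimately show ?thesis using \<open>v > 0\<close> by (simp add: mult_pos_neg)
  next
    case 2
    then obtain s where "v < s" "s < K" "integral {0..K} f - integral {0..v} f = (K - v) * f s"
      using potential_mean_value[OF cont, of v K] \<open>v > 0\<close> by auto
    moreover have "f s > 0"
      using f 2 calculation unfolding bistable_def by auto
    ultimately have "(K - v) * f s > 0" using 2 by simp
    with \<open>integral {0..K} f - integral {0..v} f = (K - v) * f s\<close> show ?thesis
      using neg by linarith
  next
    case 3
    then show ?thesis using neg by simp
  next
    case 4
    have "K > 0" using f unfolding bistable_def by linarith
    then obtain s where "K < s" "s < v" "integral {0..v} f - integral {0..K} f = (v - K) * f s"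
      using potential_mean_value[OF cont, of K v] 4 by auto
    moreover have "f s < 0"
      using f calculation unfolding bistable_def by auto
    ultimately have "(v - K) * f s < 0" using 4 by (simp add: mult_pos_neg)
    with \<open>integral {0..v} f - integral {0..K} f = (v - K) * f s\<close> show ?thesis
      using neg by linarith
  qed
qed

text \<open>
  Near \<open>0\<close> the bound comes from \<open>f'(0) < 0\<close>; away from \<open>0\<close> it comes from compactness, since the
  potential is continuous and negative. The margin \<open>k * v\<^sup>2\<close> is what later leaves room for a
  profile with a strict differential inequality.
\<close>

lemma bistable_potential_quadratic:
  fixes f :: "real \<Rightarrow> real"
  assumes f_C1: "f C1_differentiable_on UNIV" and f: "bistable f \<theta> K"
    and neg: "integral {0..K} f < 0" and "M > 0"
  obtains k where "k > 0" "\<And>v. 0 \<le> v \<Longrightarrow> v \<le> M \<Longrightarrow> integral {0..v} f \<le> - k * v\<^sup>2"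
proof -
  have cont: "continuous_on UNIV f"
    using f_C1 by (rule C1_differentiable_imp_continuous_on)
  define m where "m = - deriv f 0 / 2"
  have f0: "f 0 = 0" and "deriv f 0 < 0" using f unfolding bistable_def by blast+
  then have "m > 0" by (simp add: m_def)
  have "f differentiable (at 0)"
    using f_C1 by (auto simp: C1_differentiable_on_def intro: differentiableI_vector)
  then have "(f has_real_derivative deriv f 0) (at 0)"
    using DERIV_deriv_iff_real_differentiable by blast
  then have "((\<lambda>s. f s + m * s) has_real_derivative deriv f 0 + m) (at 0)"
    by (rule DERIV_add) (rule DERIV_cmult_Id)
  then have "((\<lambda>s. f s + m * s) has_real_derivative - m) (at 0)"
    by (simp add: m_def)
  from DERIV_neg_dec_right[OF this] \<open>m > 0\<close>
  obtain \<delta> where "\<delta> > 0" "\<forall>h>0. h < \<delta> \<longrightarrow> f (0 + h) + m * (0 + h) < f 0 + m * 0" by auto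
  then have \<delta>: "f s + m * s < 0" if "0 < s" "s < \<delta>" for s
    using that f0 by simp
  have near: "integral {0..v} f \<le> - (m / 2) * v\<^sup>2" if "0 \<le> v" "v < \<delta>" for v
  proof (cases "v = 0")
    case False
    let ?g = "\<lambda>v. integral {0..v} f + m / 2 * v\<^sup>2"
    have "?g v \<le> ?g 0"
    proof (rule DERIV_nonpos_imp_decreasing_open[where f = ?g])
      show "0 \<le> v" by fact
      show "continuous_on {0..v} ?g"
        by (intro continuous_intros potential_continuous_on cont)
      fix s assume "0 < s" "s < v"
      then have "(?g has_real_derivative f s + m * s) (at s)" "f s + m * s \<le> 0"
        using \<delta>[of s] that by (auto intro!: derivative_eq_intros potential_has_derivative cont)
      then show "\<exists>y. (?g has_real_derivative y) (at s) \<and> y \<le> 0" by blast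
    qed
    then show ?thesis by simp
  qed simp
  define a where "a = min (\<delta> / 2) M"
  have a: "0 < a" "a \<le> M" "a < \<delta>" using \<open>\<delta> > 0\<close> \<open>M > 0\<close> by (auto simp: a_def)
  have sup: "continuous_on {a..M} (\<lambda>v. integral {0..v} f)"
    using a by (intro continuous_on_subset[OF potential_continuous_on[OF cont, of M]]) auto
  then obtain w where w: "w \<in> {a..M}" "\<And>v. v \<in> {a..M} \<Longrightarrow> integral {0..v} f \<le> integral {0..w} f"
    using continuous_attains_sup[OF compact_Icc _ sup] a by auto
  define g where "g = - integral {0..w} f"
  have "g > 0"
    using bistable_potential_negative[OF cont f neg, of w] w a by (simp add: g_def)
  define k where "k = min (m / 2) (g / M\<^sup>2)"
  have far: "integral {0..v} f \<le> - (g / M\<^sup>2) * v\<^sup>2" if "a \<le> v" "v \<le> M" for v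
  proof -
    have "v\<^sup>2 \<le> M\<^sup>2" using that a by (intro power_mono) auto
    then have "g * v\<^sup>2 \<le> g * M\<^sup>2" using \<open>g > 0\<close> by simp
    then have "g / M\<^sup>2 * v\<^sup>2 \<le> g" using \<open>M > 0\<close> by (simp add: field_simps)
    then show ?thesis using w(2)[of v] that by (simp add: g_def)
  qed
  show ?thesis
  proof (rule that[of k])
    show "k > 0" using \<open>m > 0\<close> \<open>g > 0\<close> \<open>M > 0\<close> by (simp add: k_def)
    fix v :: real assume v: "0 \<le> v" "v \<le> M"
    have "k * v\<^sup>2 \<le> m / 2 * v\<^sup>2" "k * v\<^sup>2 \<le> g / M\<^sup>2 * v\<^sup>2"
      unfolding k_def by (rule mult_right_mono[OF min.cobounded1], simp, rule mult_right_mono[OF min.cobounded2], simp)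
    then show "integral {0..v} f \<le> - k * v\<^sup>2"
      using near[of v] far[of v] v a by (cases "v < \<delta>") auto
  qed
qed

section \<open>Profiles in the phase plane\<close>

text \<open>
  An increasing profile \<open>V\<close> can be described by its slope as a function of its value, \<open>V' = p(V)\<close>;
  then \<open>V'' = p'(V) p(V)\<close>, so \<open>(d/2) p\<^sup>2\<close> is determined by its derivative. Solving for the right-hand
  side \<open>- k v\<close> gives \<open>d p\<^sup>2 = - 2 \<integral>\<^sub>0\<^sup>v f - k v\<^sup>2\<close>, which is positive because the potential is at most
  \<open>- k v\<^sup>2\<close>; this is where the sign of the integral of \<open>f\<close> enters. Up to the loss \<open>k v\<^sup>2\<close> it is the
  zero-energy orbit leaving \<open>0\<close>, which never turns back. Above \<open>M\<close> the slope is continued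
  linearly, so that the profile neither stops nor blows up. The differential equation stops at \<open>M\<close>
  because \<open>M\<close> is meant to be an upper bound of the solution, which meets a profile only below it.
\<close>

lemma bistable_profile_slope:
  fixes f :: "real \<Rightarrow> real"
  assumes f_C1: "f C1_differentiable_on UNIV" and f: "bistable f \<theta> K"
    and neg: "integral {0..K} f < 0" and "d > 0" "M > 0"
  obtains p p' :: "real \<Rightarrow> real" and c C k where "c > 0" "C > 0" "k > 0" "continuous_on {0<..} p"
    "\<And>v. v > 0 \<Longrightarrow> c * v \<le> p v \<and> p v \<le> C * v"
    "\<And>v. 0 < v \<Longrightarrow> v < M \<Longrightarrow> (p has_real_derivative p' v) (at v)"
    "\<And>v. 0 < v \<Longrightarrow> v < M \<Longrightarrow> d * (p' v * p v) + f v = - k * v"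
proof -
  have cont: "continuous_on UNIV f"
    using f_C1 by (rule C1_differentiable_imp_continuous_on)
  obtain k where "k > 0" and k: "\<And>v. 0 \<le> v \<Longrightarrow> v \<le> M \<Longrightarrow> integral {0..v} f \<le> - k * v\<^sup>2"
    using bistable_potential_quadratic[OF f_C1 f neg \<open>M > 0\<close>] by blast
  obtain L where "L > 0" and L: "\<And>x y. x \<in> {0..M} \<Longrightarrow> y \<in> {0..M} \<Longrightarrow> \<bar>f x - f y\<bar> \<le> L * \<bar>x - y\<bar>"
    using C1_lipschitz_on_Icc[OF f_C1] by blast
  have f0: "f 0 = 0" using f unfolding bistable_def by blast
  define P where "P v = (- 2 * integral {0..v} f - k * v\<^sup>2) / d" for v
  \<comment> \<open>For \<open>v \<le> M\<close> the second factor is \<open>1\<close>; for \<open>v \<ge> M\<close> the first one is constant.\<close>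
  define p where "p v = sqrt (P (min v M)) * (max v M / M)" for v
  define p' where "p' v = (- 2 * f v - 2 * k * v) / d / (2 * sqrt (P v))" for v
  define c where "c = sqrt (k / d)"
  define C where "C = sqrt (2 * L / d)"
  have P_low: "k / d * v\<^sup>2 \<le> P v" if "0 \<le> v" "v \<le> M" for v
    using k[OF that] \<open>d > 0\<close> by (simp add: P_def divide_right_mono)
  have P_pos: "P v > 0" if "0 < v" "v \<le> M" for v
    using P_low[of v] that \<open>k > 0\<close> \<open>d > 0\<close> by (smt (verit) divide_pos_pos mult_pos_pos zero_less_power)
  have P_up: "P v \<le> 2 * L / d * v\<^sup>2" if "0 < v" "v \<le> M" for v
  proof -
    obtain s where s: "0 < s" "s < v" "integral {0..v} f - integral {0..0} f = (v - 0) * f s"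
      using potential_mean_value[OF cont, of 0 v] \<open>0 < v\<close> by auto
    have "- f s \<le> L * s"
      using L[of s 0] s that f0 by auto
    also have "\<dots> \<le> L * v" using s \<open>L > 0\<close> by simp
    finally have "v * (- f s) \<le> v * (L * v)"
      using that by (intro mult_left_mono) auto
    then have "- integral {0..v} f \<le> L * v\<^sup>2"
      using s by (simp add: power2_eq_square mult_ac)
    moreover have "k * v\<^sup>2 \<ge> 0" using \<open>k > 0\<close> by simp
    ultimately have "- 2 * integral {0..v} f - k * v\<^sup>2 \<le> 2 * L * v\<^sup>2" by linarith
    then show ?thesis
      using \<open>d > 0\<close> by (simp add: P_def divide_right_mono)
  qed
  have sqrt_bounds: "c * v \<le> sqrt (P v) \<and> sqrt (P v) \<le> C * v" if "0 < v" "v \<le> M" for v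
  proof -
    have "sqrt (k / d * v\<^sup>2) \<le> sqrt (P v)" "sqrt (P v) \<le> sqrt (2 * L / d * v\<^sup>2)"
      using P_low[of v] P_up[of v] that by (auto simp del: real_sqrt_le_iff intro!: real_sqrt_le_mono)
    moreover have "sqrt (a * v\<^sup>2) = sqrt a * v" for a
      using that by (simp only: real_sqrt_mult) simp
    ultimately show ?thesis
      by (simp only: c_def C_def)
  qed
  have P_deriv: "(P has_real_derivative (- 2 * f v - 2 * k * v) / d) (at v)" if "v > 0" for v
    unfolding P_def using that \<open>d > 0\<close>
    by (auto intro!: derivative_eq_intros potential_has_derivative cont)
  show ?thesis
  proof (rule that[of c C k p p'])
    show "c > 0" "C > 0" "k > 0"
      using \<open>k > 0\<close> \<open>d > 0\<close> \<open>L > 0\<close> by (auto simp: c_def C_def)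
    have "continuous_on {0<..} P"
      using P_deriv by (meson DERIV_isCont continuous_at_imp_continuous_on greaterThan_iff)
    then have "continuous_on {0<..} (\<lambda>v. P (min v M))"
      by (rule continuous_on_compose2) (use \<open>M > 0\<close> in \<open>auto intro!: continuous_intros\<close>)
    then show "continuous_on {0<..} p"
      unfolding p_def using \<open>M > 0\<close> by (intro continuous_intros) auto
    fix v :: real assume "v > 0"
    define w where "w = min v M"
    have w: "0 < w" "w \<le> M" "w * (max v M / M) = v"
      using \<open>v > 0\<close> \<open>M > 0\<close> by (auto simp: w_def min_def max_def)
    have "max v M / M > 0" using \<open>M > 0\<close> by auto
    then have "c * w * (max v M / M) \<le> p v \<and> p v \<le> C * w * (max v M / M)"
      using sqrt_bounds[OF w(1,2)] unfolding p_def w_def[symmetric]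
      by (intro conjI mult_right_mono) auto
    then show "c * v \<le> p v \<and> p v \<le> C * v"
      by (simp only: mult.assoc w(3))
  next
    fix v :: real assume v: "0 < v" "v < M"
    have "((\<lambda>v. sqrt (P v)) has_real_derivative p' v) (at v)"
      using P_pos[of v] v P_deriv[of v] by (auto intro!: derivative_eq_intros simp: p'_def field_simps)
    moreover have "eventually (\<lambda>x. sqrt (P x) = p x) (nhds v)"
      using eventually_nhds_in_open[of "{..<M}" v] v by (auto elim!: eventually_mono simp: p_def min_def max_def)
    ultimately show "(p has_real_derivative p' v) (at v)"
      by (subst DERIV_cong_ev[OF refl _ refl, symmetric])
    have "p' v * p v = (- 2 * f v - 2 * k * v) / d / 2"
      using P_pos[of v] v by (simp add: p'_def p_def min_def max_def)
    then show "d * (p' v * p v) + f v = - k * v"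
      using \<open>d > 0\<close> by (simp add: field_simps)
  qed
qed

text \<open>
  The autonomous equation \<open>V' = p(V)\<close> becomes \<open>Y' = q(Y)\<close> for \<open>Y = ln V\<close>, with \<open>q\<close> between the positive
  constants \<open>c\<close> and \<open>C\<close>. Hence \<open>1/q\<close> has an antiderivative \<open>A\<close> that maps the real line onto itself, and
  \<open>Y\<close> is its inverse. The value \<open>A l\<close> is the position at which the profile has height \<open>exp l\<close>; it is
  kept because two profiles have to be slid so that their heights at the interface agree.
\<close>

lemma sliding_profile:
  fixes p :: "real \<Rightarrow> real"
  assumes "c > 0" "C > 0" and cont: "continuous_on {0<..} p"
    and bounds: "\<And>v. v > 0 \<Longrightarrow> c * v \<le> p v \<and> p v \<le> C * v"
  obtains V A :: "real \<Rightarrow> real" where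
    "\<And>s. V s > 0" "mono V" "mono A"
    "\<And>s. (V has_real_derivative p (V s)) (at s)"
    "\<And>l. (A has_real_derivative exp l / p (exp l)) (at l)"
    "\<And>l. V (A l) = exp l" "\<And>s. A (ln (V s)) = s"
proof -
  define r where "r l = exp l / p (exp l)" for l :: real
  define A where "A l = (LBINT y=0..l. r y)" for l :: real
  have ppos: "p v > 0" if "v > 0" for v
    using bounds[OF that] \<open>c > 0\<close> that by (smt (verit) mult_pos_pos)
  have r_cont: "continuous_on S r" for S
  proof -
    have "continuous_on S (\<lambda>l. p (exp l))"
      by (rule continuous_on_compose2[OF cont]) (auto intro!: continuous_intros)
    then show ?thesis
      unfolding r_def using ppos by (intro continuous_intros) (auto simp: less_imp_neq[symmetric])
  qed
  have r_pos: "r l > 0" for l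
    by (simp add: r_def ppos)
  have r_low: "r l \<ge> 1 / C" for l
    using bounds[of "exp l"] ppos[of "exp l"] \<open>C > 0\<close> by (simp add: r_def field_simps)
  have A': "(A has_real_derivative r l) (at l)" for l
  proof -
    have "(A has_vector_derivative r l) (at l within {- \<bar>l\<bar> - 1 .. \<bar>l\<bar> + 1})"
      unfolding A_def zero_ereal_def
      by (rule interval_integral_FTC2[OF _ _ r_cont]) auto
    moreover have "at l within {- \<bar>l\<bar> - 1 .. \<bar>l\<bar> + 1} = at l"
      by (rule at_within_interior) auto
    ultimately show ?thesis
      by (simp add: has_real_derivative_iff_has_vector_derivative)
  qed
  have A_expand: "(y - x) / C \<le> A y - A x" if "x \<le> y" for x y
  proof (cases "x = y")
    case False
    with that obtain z where "A y - A x = (y - x) * r z"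
      using MVT2[of x y A r] A' by auto
    then show ?thesis
      using r_low[of z] that by (simp add: divide_inverse mult_left_mono)
  qed simp
  have A_less: "A x < A y" if "x < y" for x y
    using A_expand[of x y] that \<open>C > 0\<close> by (smt (verit) divide_pos_pos)
  have A_cont: "continuous_on S A" for S
    using A' by (meson DERIV_isCont continuous_at_imp_continuous_on)
  have "\<exists>l. A l = s" for s
  proof -
    \<comment> \<open>The slope of \<open>A\<close> is at least \<open>1 / C\<close>, so these two points enclose a preimage of \<open>s\<close>.\<close>
    have "A (- C * \<bar>s - A 0\<bar>) \<le> s" "s \<le> A (C * \<bar>s - A 0\<bar>)"
      using A_expand[of "- C * \<bar>s - A 0\<bar>" 0] A_expand[of 0 "C * \<bar>s - A 0\<bar>"] \<open>C > 0\<close> by auto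
    moreover have "- C * \<bar>s - A 0\<bar> \<le> C * \<bar>s - A 0\<bar>"
      using \<open>C > 0\<close> by (simp add: mult_left_mono)
    ultimately show ?thesis
      using IVT'[OF _ _ _ A_cont] by blast
  qed
  then obtain Y where AY: "\<And>s. A (Y s) = s" by metis
  have YA: "Y (A l) = l" for l
    using A_less AY by (metis linorder_neqE_linordered_idom order_less_irrefl)
  have Y_mono: "Y s \<le> Y s'" if "s \<le> s'" for s s'
    using A_less AY that by (metis linorder_not_less)
  have Y': "(Y has_real_derivative inverse (r (Y s))) (at s)" for s
  proof (rule DERIV_inverse_function[where f = A and a = "s - 1" and b = "s + 1"])
    show "(A has_real_derivative r (Y s)) (at (Y s))" by (rule A')
    show "r (Y s) \<noteq> 0" using r_pos by (simp add: less_imp_neq[symmetric])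
    have "isCont Y (A (Y s))"
      by (rule isCont_inverse_function[where d = 1]) (auto simp: YA intro: DERIV_isCont[OF A'])
    then show "isCont Y s" by (simp add: AY)
  qed (auto simp: AY)
  show ?thesis
  proof (rule that[of "\<lambda>s. exp (Y s)" A])
    show "mono (\<lambda>s. exp (Y s))" using Y_mono by (auto intro: monoI)
    show "mono A" using A_less by (auto intro!: monoI simp: le_less)
    show "((\<lambda>s. exp (Y s)) has_real_derivative p (exp (Y s))) (at s)" for s
      using ppos[of "exp (Y s)"] by (auto intro!: derivative_eq_intros Y' simp: r_def)
  qed (use A' AY YA in \<open>auto simp: r_def\<close>)
qed

section \<open>Retreating profiles\<close>

text \<open>
  With \<open>l\<close> moving at the constant speed \<open>- e\<close>, the function \<open>V (x + A (l - e t))\<close> has height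
  \<open>exp (l - e t)\<close> at \<open>x = 0\<close>. The last condition says that it is a supersolution of
  \<open>u\<^sub>t = d u\<^sub>x\<^sub>x + f(u)\<close> where it is below \<open>M\<close>; it is demanded for all \<open>l\<close>, independently of \<open>s\<close>, because
  the position of the profile and the point of contact are not related in advance. The equation is
  invariant under reflection, so the mirror image serves in the other patch.
\<close>

definition retreating_profile ::
  "real \<Rightarrow> (real \<Rightarrow> real) \<Rightarrow> real \<Rightarrow> real \<Rightarrow> (real \<Rightarrow> real) \<Rightarrow> (real \<Rightarrow> real) \<Rightarrow> (real \<Rightarrow> real) \<Rightarrow>
   (real \<Rightarrow> real) \<Rightarrow> (real \<Rightarrow> real) \<Rightarrow> bool" where
  "retreating_profile d f M e V V' V'' A A' \<longleftrightarrow>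
     mono V \<and> mono A \<and> (\<forall>l. V (A l) = exp l) \<and> (\<forall>s. A (ln (V s)) = s) \<and>
     (\<forall>s. 0 < V s \<and> 0 < V' s \<and> (V has_real_derivative V' s) (at s)) \<and>
     (\<forall>l. (A has_real_derivative A' l) (at l)) \<and>
     (\<forall>s. V s < M \<longrightarrow> (V' has_real_derivative V'' s) (at s) \<and>
        (\<forall>l. d * V'' s + f (V s) \<le> - e * A' l * V' s))"

text \<open>
  The surplus \<open>k V\<close> in \<open>d V'' + f(V) = - k V\<close> pays for the sliding: the profile falls at rate at most
  \<open>e / c * V'\<close>, and \<open>V' \<le> C V\<close>. Every sufficiently small rate \<open>e\<close> is admissible with the same profile,
  which allows a common rate for the two patches.
\<close>

lemma bistable_retreating_profile:
  fixes f :: "real \<Rightarrow> real"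
  assumes f_C1: "f C1_differentiable_on UNIV" and f: "bistable f \<theta> K"
    and neg: "integral {0..K} f < 0" and "d > 0" "M > 0"
  obtains e0 V V' V'' A A' where "e0 > 0"
    "\<And>e. 0 \<le> e \<Longrightarrow> e \<le> e0 \<Longrightarrow> retreating_profile d f M e V V' V'' A A'"
proof -
  obtain p p' c C k where pos: "c > 0" "C > 0" "k > 0" and p_cont: "continuous_on {0<..} p"
    and bounds: "\<And>v. v > 0 \<Longrightarrow> c * v \<le> p v \<and> p v \<le> C * v"
    and p': "\<And>v. 0 < v \<Longrightarrow> v < M \<Longrightarrow> (p has_real_derivative p' v) (at v)"
    and ode: "\<And>v. 0 < v \<Longrightarrow> v < M \<Longrightarrow> d * (p' v * p v) + f v = - k * v"
    using bistable_profile_slope[OF assms] by metis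
  obtain V A where V_pos: "\<And>s. V s > 0" and mono: "mono V" "mono A"
    and V': "\<And>s. (V has_real_derivative p (V s)) (at s)"
    and A': "\<And>l. (A has_real_derivative exp l / p (exp l)) (at l)"
    and inv: "\<And>l. V (A l) = exp l" "\<And>s. A (ln (V s)) = s"
    using sliding_profile[OF pos(1,2) p_cont bounds] by metis
  have p_pos: "p v > 0" if "v > 0" for v
    using bounds[OF that] mult_pos_pos[OF pos(1) that] by linarith
  have speed: "e * (exp l / p (exp l)) * p (V s) \<le> k * V s" if "0 \<le> e" "e \<le> k * c / C" for e l s
  proof -
    have "exp l / p (exp l) \<le> 1 / c"
      using bounds[of "exp l"] p_pos[of "exp l"] pos by (simp add: field_simps)
    then have slide: "e * (exp l / p (exp l)) \<le> (k * c / C) * (1 / c)"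
      using that pos p_pos[of "exp l"] by (intro mult_mono) auto
    have "e * (exp l / p (exp l)) * p (V s) \<le> (k * c / C) * (1 / c) * (C * V s)"
      using bounds[of "V s"] p_pos[of "V s"] V_pos[of s] pos by (intro mult_mono[OF slide]) auto
    also have "\<dots> = k * V s" using pos by simp
    finally show ?thesis .
  qed
  show ?thesis
  proof (rule that[of "k * c / C" V "\<lambda>s. p (V s)" "\<lambda>s. p' (V s) * p (V s)" A "\<lambda>l. exp l / p (exp l)"])
    show "k * c / C > 0" using pos by simp
    fix e assume e: "0 \<le> e" "e \<le> k * c / C"
    have "((\<lambda>s. p (V s)) has_real_derivative p' (V s) * p (V s)) (at s)" if "V s < M" for s
      using p'[OF V_pos that] V' by (rule DERIV_chain2)
    moreover have "d * (p' (V s) * p (V s)) + f (V s) \<le> - e * (exp l / p (exp l)) * p (V s)"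
      if "V s < M" for s l
      using ode[OF V_pos that] speed[OF e, of l s] by simp
    ultimately show "retreating_profile d f M e V (\<lambda>s. p (V s)) (\<lambda>s. p' (V s) * p (V s)) A (\<lambda>l. exp l / p (exp l))"
      unfolding retreating_profile_def using mono inv V_pos p_pos V' A' by blast
  qed
qed

text \<open>
  Profiles increase to infinity without blowing up, so a profile can be placed above \<open>M\<close> on any
  bounded set: the barrier can start above compactly supported data.
\<close>

lemma retreating_profile_large:
  assumes prof: "retreating_profile d f M e V V' V'' A A'" and "M > 0"
  obtains l where "\<And>l' s. l \<le> l' \<Longrightarrow> \<bar>s\<bar> \<le> R \<Longrightarrow> M \<le> V (s + A l')"
proof -
  have mono: "mono V" "mono A" and inv: "\<And>l. V (A l) = exp l" "\<And>s. A (ln (V s)) = s"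
    using prof unfolding retreating_profile_def by blast+
  show ?thesis
  proof (rule that[of "ln (V (R + A (ln M)))"])
    fix l' s :: real assume *: "ln (V (R + A (ln M))) \<le> l'" "\<bar>s\<bar> \<le> R"
    have "R + A (ln M) \<le> A l'"
      using monoD[OF mono(2) *(1)] inv(2) by simp
    then have "V (A (ln M)) \<le> V (s + A l')"
      using * by (intro monoD[OF mono(1)]) (simp add: abs_le_iff)
    then show "M \<le> V (s + A l')" using inv(1) \<open>M > 0\<close> by simp
  qed
qed

section \<open>Comparison with the tent-shaped barrier\<close>

text \<open>
  The maximum principle at an interior point, in a form that covers both patches: \<open>sg\<close> is \<open>1\<close> for a
  profile and \<open>-1\<close> for its mirror image. The term \<open>\<eta> * (1 + x\<^sup>2) * exp (B * t)\<close> prevents contact at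
  infinity. Its time derivative, with factor \<open>B\<close>, exceeds what it contributes through diffusion
  (at most \<open>2 d\<close>) and through the Lipschitz constant of the reaction (at most \<open>L\<close>).
\<close>

lemma no_contact_inside_patch:
  fixes u :: "real \<Rightarrow> real \<Rightarrow> real"
  assumes prof: "retreating_profile d f M e V V' V'' A A'"
    and sg: "sg\<^sup>2 = 1" and "d > 0" "\<eta> > 0" "B > 2 * d + L" "t0 > 0" "r > 0"
    and lip: "\<And>x y. x \<in> {0..M} \<Longrightarrow> y \<in> {0..M} \<Longrightarrow> \<bar>f x - f y\<bar> \<le> L * \<bar>x - y\<bar>"
    and ut: "((\<lambda>s. u s x0) has_real_derivative ut) (at t0)"
    and ux: "\<And>y. \<bar>y - x0\<bar> < r \<Longrightarrow> ((\<lambda>y. u t0 y) has_real_derivative ux y) (at y)"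
    and uxx: "(ux has_real_derivative uxx) (at x0)"
    and pde: "ut = d * uxx + f (u t0 x0)"
    and "u t0 x0 < M"
    and contact: "u t0 x0 = V (sg * x0 + A (l0 - e * t0)) + \<eta> * (1 + x0\<^sup>2) * exp (B * t0)"
    and before: "\<And>t. 0 \<le> t \<Longrightarrow> t < t0 \<Longrightarrow> u t x0 \<le> V (sg * x0 + A (l0 - e * t)) + \<eta> * (1 + x0\<^sup>2) * exp (B * t)"
    and now: "\<And>y. \<bar>y - x0\<bar> < r \<Longrightarrow> u t0 y \<le> V (sg * y + A (l0 - e * t0)) + \<eta> * (1 + y\<^sup>2) * exp (B * t0)"
  shows False
proof -
  define s where "s = sg * x0 + A (l0 - e * t0)"
  define E where "E = \<eta> * exp (B * t0)"
  define \<psi> where "\<psi> = 1 + x0\<^sup>2"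
  have "E > 0" "\<psi> \<ge> 1" using \<open>\<eta> > 0\<close> by (auto simp: E_def \<psi>_def)
  have V_pos: "V y > 0"
    and V': "(g has_real_derivative g') (at y) \<Longrightarrow>
      ((\<lambda>y. V (g y)) has_real_derivative V' (g y) * g') (at y)"
    and A': "(g has_real_derivative g') (at y) \<Longrightarrow>
      ((\<lambda>y. A (g y)) has_real_derivative A' (g y) * g') (at y)" for g g' y
    using prof unfolding retreating_profile_def by (blast intro: DERIV_chain2)+
  have touch: "u t0 x0 = V s + E * \<psi>"
    using contact by (simp add: s_def E_def \<psi>_def)
  have "E * \<psi> > 0" using \<open>E > 0\<close> \<open>\<psi> \<ge> 1\<close> by simp
  then have "V s < M" using touch \<open>u t0 x0 < M\<close> by linarith
  then have V'': "(V' has_real_derivative V'' s) (at s)"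
    and super: "d * V'' s + f (V s) \<le> - e * A' (l0 - e * t0) * V' s"
    using prof by (auto simp: retreating_profile_def)
  have time: "ut \<ge> - e * A' (l0 - e * t0) * V' s + B * E * \<psi>"
  proof -
    have "((\<lambda>t. u t x0 - V (sg * x0 + A (l0 - e * t)) - \<eta> * (1 + x0\<^sup>2) * exp (B * t))
        has_real_derivative ut - V' s * (A' (l0 - e * t0) * (- e)) - \<eta> * (1 + x0\<^sup>2) * (exp (B * t0) * B))
        (at t0 within {..t0})"
      by (rule has_field_derivative_at_within)
        (auto intro!: derivative_eq_intros ut V' A' simp: s_def)
    then have "ut - V' s * (A' (l0 - e * t0) * (- e)) - \<eta> * (1 + x0\<^sup>2) * (exp (B * t0) * B) \<ge> 0"
    proof (rule derivative_nonneg_at_left_max[OF _ \<open>t0 > 0\<close>])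
      fix t :: real assume "0 \<le> t" "t < t0"
      then show "u t x0 - V (sg * x0 + A (l0 - e * t)) - \<eta> * (1 + x0\<^sup>2) * exp (B * t)
          \<le> u t0 x0 - V (sg * x0 + A (l0 - e * t0)) - \<eta> * (1 + x0\<^sup>2) * exp (B * t0)"
        using before[of t] contact by linarith
    qed
    then show ?thesis by (simp add: E_def \<psi>_def algebra_simps)
  qed
  have space: "uxx \<le> V'' s + 2 * E"
  proof -
    have "uxx - V'' s - 2 * E \<le> 0"
    proof (rule second_derivative_nonpos_at_local_max[OF \<open>r > 0\<close>, where
          g = "\<lambda>y. u t0 y - V (sg * y + A (l0 - e * t0)) - \<eta> * (1 + y\<^sup>2) * exp (B * t0)" and
          g' = "\<lambda>y. ux y - sg * V' (sg * y + A (l0 - e * t0)) - 2 * E * y" and x = x0])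
      fix y assume y: "\<bar>y - x0\<bar> < r"
      show "((\<lambda>y. u t0 y - V (sg * y + A (l0 - e * t0)) - \<eta> * (1 + y\<^sup>2) * exp (B * t0))
         has_real_derivative ux y - sg * V' (sg * y + A (l0 - e * t0)) - 2 * E * y) (at y)"
        by (auto intro!: derivative_eq_intros ux[OF y] V' simp: E_def)
      show "u t0 y - V (sg * y + A (l0 - e * t0)) - \<eta> * (1 + y\<^sup>2) * exp (B * t0)
          \<le> u t0 x0 - V (sg * x0 + A (l0 - e * t0)) - \<eta> * (1 + x0\<^sup>2) * exp (B * t0)"
        using now[OF y] contact by simp
    next
      have sg_cancel: "sg * (V'' s * sg) = V'' s" using sg by algebra
      have "((\<lambda>y. V' (sg * y + A (l0 - e * t0))) has_real_derivative V'' s * sg) (at x0)"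
        using V'' unfolding s_def by (rule DERIV_chain2) (auto intro!: derivative_eq_intros)
      then have "((\<lambda>y. ux y - sg * V' (sg * y + A (l0 - e * t0)) - 2 * E * y)
          has_real_derivative uxx - sg * (V'' s * sg) - 2 * E) (at x0)"
        by (auto intro!: derivative_eq_intros uxx)
      then show "((\<lambda>y. ux y - sg * V' (sg * y + A (l0 - e * t0)) - 2 * E * y)
          has_real_derivative uxx - V'' s - 2 * E) (at x0)"
        by (simp only: sg_cancel)
    qed
    then show ?thesis by simp
  qed
  have "\<bar>f (u t0 x0) - f (V s)\<bar> \<le> L * \<bar>u t0 x0 - V s\<bar>"
    by (rule lip) (use touch \<open>E * \<psi> > 0\<close> V_pos[of s] \<open>u t0 x0 < M\<close> in auto)
  then have reaction: "f (u t0 x0) \<le> f (V s) + L * (E * \<psi>)"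
    using touch \<open>E * \<psi> > 0\<close> by simp
  have "- e * A' (l0 - e * t0) * V' s + B * E * \<psi> \<le> d * (V'' s + 2 * E) + f (V s) + L * (E * \<psi>)"
    using time pde mult_left_mono[OF space, of d] reaction \<open>d > 0\<close> by linarith
  then have "B * (E * \<psi>) \<le> 2 * d * E + L * (E * \<psi>)"
    using super by (simp add: algebra_simps)
  also have "2 * d * E \<le> 2 * d * (E * \<psi>)"
    using \<open>d > 0\<close> \<open>E > 0\<close> \<open>\<psi> \<ge> 1\<close> by simp
  finally have "B * (E * \<psi>) \<le> (2 * d + L) * (E * \<psi>)" by (simp add: algebra_simps)
  then have "B \<le> 2 * d + L" using \<open>E * \<psi> > 0\<close> by (rule mult_right_le_imp_le)
  then show False using \<open>B > 2 * d + L\<close> by linarith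
qed

text \<open>
  The tent is a minimum of the two profiles, which makes its continuity obvious; this identifies the
  branch on each side of the interface, where both profiles have height \<open>exp l\<close>. The right branch
  follows by reflection.
\<close>

lemma barrier_eq_left:
  assumes "mono V1" "mono V2" "\<And>l. V1 (A1 l) = exp l" "\<And>l. V2 (A2 l) = exp l" "x \<le> (0 :: real)"
  shows "min (V1 (x + A1 l)) (V2 (- x + A2 l)) = (V1 (x + A1 l) :: real)"
  using monoD[OF assms(1), of "x + A1 l" "A1 l"] monoD[OF assms(2), of "A2 l" "- x + A2 l"] assms(3-5)
  by (simp add: min_def)

text \<open>
  Inside a patch a first contact contradicts the supersolution inequality. At the interface the
  barrier has a concave kink: at a contact the solution would satisfy
  \<open>u\<^sub>x(t,0-) > 0 > u\<^sub>x(t,0+)\<close>, which is incompatible with the flux condition whatever the value of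
  \<open>\<sigma> > 0\<close>. The perturbation is even and smooth, so it does not affect the kink; it is removed in the
  limit \<open>\<eta> \<rightarrow> 0\<close>.
\<close>

lemma classical_solution_below_barrier:
  fixes u :: "real \<Rightarrow> real \<Rightarrow> real"
  assumes d: "d1 > 0" "d2 > 0" "\<sigma> > 0"
    and f_C1: "f1 C1_differentiable_on UNIV" "f2 C1_differentiable_on UNIV"
    and sol: "classical_solution d1 d2 \<sigma> f1 f2 u0 u"
    and u_less: "\<And>t x. 0 \<le> t \<Longrightarrow> u t x < M"
    and prof1: "retreating_profile d1 f1 M e V1 V1' V1'' A1 A1'"
    and prof2: "retreating_profile d2 f2 M e V2 V2' V2'' A2 A2'"
    and init: "\<And>x. u0 x \<le> min (V1 (x + A1 l0)) (V2 (- x + A2 l0))"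
    and "t \<ge> 0"
  shows "u t x \<le> min (V1 (x + A1 (l0 - e * t))) (V2 (- x + A2 (l0 - e * t)))"
proof -
  obtain ut1 ux1 uxx1 ut2 ux2 uxx2 where
    C1: "C12_derivs {..0} u ut1 ux1 uxx1" and C2: "C12_derivs {0..} u ut2 ux2 uxx2" and
    pde1: "\<And>t x. t > 0 \<Longrightarrow> x < 0 \<Longrightarrow> ut1 t x = d1 * uxx1 t x + f1 (u t x)" and
    pde2: "\<And>t x. t > 0 \<Longrightarrow> x > 0 \<Longrightarrow> ut2 t x = d2 * uxx2 t x + f2 (u t x)" and
    flux: "\<And>t. t > 0 \<Longrightarrow> ux1 t 0 = \<sigma> * ux2 t 0"
    using sol unfolding classical_solution_def by blast
  have u_cont: "continuous_on ({0..} \<times> UNIV) (\<lambda>(t, x). u t x)" and u_init: "\<And>x. u 0 x = u0 x"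
    using sol unfolding classical_solution_def by blast+
  have V1: "mono V1" "\<And>l. V1 (A1 l) = exp l" "\<And>s. V1 s > 0" "\<And>s. V1' s > 0"
      "\<And>s. (V1 has_real_derivative V1' s) (at s)" "\<And>l. (A1 has_real_derivative A1' l) (at l)"
    using prof1 unfolding retreating_profile_def by blast+
  have V2: "mono V2" "\<And>l. V2 (A2 l) = exp l" "\<And>s. V2 s > 0" "\<And>s. V2' s > 0"
      "\<And>s. (V2 has_real_derivative V2' s) (at s)" "\<And>l. (A2 has_real_derivative A2' l) (at l)"
    using prof2 unfolding retreating_profile_def by blast+
  obtain L1 where L1: "L1 > 0" "\<And>x y. x \<in> {0..M} \<Longrightarrow> y \<in> {0..M} \<Longrightarrow> \<bar>f1 x - f1 y\<bar> \<le> L1 * \<bar>x - y\<bar>"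
    using C1_lipschitz_on_Icc[OF f_C1(1)] by blast
  obtain L2 where L2: "L2 > 0" "\<And>x y. x \<in> {0..M} \<Longrightarrow> y \<in> {0..M} \<Longrightarrow> \<bar>f2 x - f2 y\<bar> \<le> L2 * \<bar>x - y\<bar>"
    using C1_lipschitz_on_Icc[OF f_C1(2)] by blast
  define B where "B = 2 * d1 + 2 * d2 + L1 + L2"
  have B: "B > 2 * d1 + L1" "B > 2 * d2 + L2" "B > 0"
    using d L1(1) L2(1) by (auto simp: B_def)
  define W where "W t x = min (V1 (x + A1 (l0 - e * t))) (V2 (- x + A2 (l0 - e * t)))" for t x
  have W_left: "W t x = V1 (x + A1 (l0 - e * t))" if "x \<le> 0" for t x
    unfolding W_def using that by (intro barrier_eq_left V1 V2)
  have W_right: "W t x = V2 (- x + A2 (l0 - e * t))" if "x \<ge> 0" for t x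
    unfolding W_def using barrier_eq_left[OF V2(1) V1(1) V2(2) V1(2), of "- x" "l0 - e * t"] that
    by (simp add: min.commute)
  have V_cont: "continuous_on S V1" "continuous_on S A1" "continuous_on S V2" "continuous_on S A2" for S
    using V1 V2 by (meson DERIV_isCont continuous_at_imp_continuous_on)+
  have W_cont: "continuous_on S (\<lambda>(t, x). W t x)" for S
    unfolding W_def case_prod_unfold
    by (intro continuous_intros continuous_on_compose2[OF V_cont(1)] continuous_on_compose2[OF V_cont(2)]
        continuous_on_compose2[OF V_cont(3)] continuous_on_compose2[OF V_cont(4)]) auto
  have relaxed: "u t x < W t x + \<eta> * (1 + x\<^sup>2) * exp (B * t)" if "\<eta> > 0" "t \<ge> 0" for \<eta> t x
  proof (rule ccontr)
    define z where "z t x = u t x - W t x - \<eta> * (1 + x\<^sup>2) * exp (B * t)" for t x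
    assume "\<not> u t x < W t x + \<eta> * (1 + x\<^sup>2) * exp (B * t)"
    then have "z t x \<ge> 0" by (simp add: z_def)
    have far: "z t x < 0" if "0 \<le> t" "\<bar>x\<bar> > \<bar>M\<bar> / \<eta> + 1" for t x
    proof -
      have "\<bar>x\<bar> * 1 \<le> \<bar>x\<bar> * \<bar>x\<bar>"
        using that \<open>\<eta> > 0\<close> by (intro mult_left_mono) (auto intro: order_trans[of _ "\<bar>M\<bar> / \<eta> + 1"])
      then have "\<bar>M\<bar> / \<eta> < 1 + x\<^sup>2" using that by (simp add: power2_eq_square)
      then have "\<bar>M\<bar> < \<eta> * (1 + x\<^sup>2)" using \<open>\<eta> > 0\<close> by (simp add: field_simps)
      also have "\<dots> * 1 \<le> \<eta> * (1 + x\<^sup>2) * exp (B * t)"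
        using \<open>\<eta> > 0\<close> that B by (intro mult_left_mono) auto
      finally have "M < \<eta> * (1 + x\<^sup>2) * exp (B * t)" by simp
      moreover have "W t x > 0" by (simp add: W_def V1(3) V2(3))
      ultimately show ?thesis using u_less[OF that(1), of x] by (simp add: z_def)
    qed
    have "z 0 x < 0" for x
    proof -
      have "u 0 x \<le> W 0 x" using init[of x] u_init by (simp add: W_def)
      moreover have "\<eta> * (1 + x\<^sup>2) > 0" using \<open>\<eta> > 0\<close> by (simp add: add_pos_nonneg)
      ultimately show ?thesis by (simp add: z_def)
    qed
    moreover have "continuous_on ({0..} \<times> UNIV) (\<lambda>(t, x). z t x)"
      using u_cont W_cont[of "{0..} \<times> UNIV"] unfolding z_def case_prod_unfold
      by (intro continuous_intros)
    ultimately obtain t0 x0 where t0: "t0 > 0" "z t0 x0 = 0" "\<And>x. z t0 x \<le> 0"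
      "\<And>t x. 0 \<le> t \<Longrightarrow> t < t0 \<Longrightarrow> z t x < 0"
      using first_contact[of z, OF _ _ far \<open>t \<ge> 0\<close> \<open>z t x \<ge> 0\<close>] by blast
    have contact: "u t0 x0 = W t0 x0 + \<eta> * (1 + x0\<^sup>2) * exp (B * t0)"
      using t0(2) by (simp add: z_def)
    have now: "u t0 x \<le> W t0 x + \<eta> * (1 + x\<^sup>2) * exp (B * t0)" for x
      using t0(3)[of x] by (simp add: z_def)
    have before: "u t x \<le> W t x + \<eta> * (1 + x\<^sup>2) * exp (B * t)" if "0 \<le> t" "t < t0" for t x
      using t0(4)[OF that, of x] by (simp add: z_def)
    consider "x0 < 0" | "x0 > 0" | "x0 = 0" by linarith
    then show False
    proof cases
      case 1
      have at: "at y within {..0} = at y" if "y < 0" for y :: real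
        using that by (intro at_within_interior) auto
      have D: "((\<lambda>s. u s y) has_real_derivative ut1 t0 y) (at t0)"
        "((\<lambda>y. u t0 y) has_real_derivative ux1 t0 y) (at y)"
        "(ux1 t0 has_real_derivative uxx1 t0 y) (at y)" if "y < 0" for y
        using C1 that t0(1) at[OF that] unfolding C12_derivs_def by (metis atMost_iff less_imp_le)+
      show False
      proof (rule no_contact_inside_patch[OF prof1 _ d(1) \<open>\<eta> > 0\<close> B(1) t0(1), where
            sg = 1 and r = "- x0" and u = u and ?x0.0 = x0 and ?l0.0 = l0 and ux = "ux1 t0"])
        show "u t0 x0 < M" using u_less t0(1) by simp
        show "u t0 x0 = V1 (1 * x0 + A1 (l0 - e * t0)) + \<eta> * (1 + x0\<^sup>2) * exp (B * t0)"
          using contact W_left[of x0 t0] 1 by simp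
        show "u t x0 \<le> V1 (1 * x0 + A1 (l0 - e * t)) + \<eta> * (1 + x0\<^sup>2) * exp (B * t)" if "0 \<le> t" "t < t0" for t
          using before[OF that, of x0] W_left[of x0 t] 1 by simp
        show "u t0 y \<le> V1 (1 * y + A1 (l0 - e * t0)) + \<eta> * (1 + y\<^sup>2) * exp (B * t0)" if "\<bar>y - x0\<bar> < - x0" for y
          using now[of y] W_left[of y t0] that by (simp add: abs_if split: if_splits)
        show "((\<lambda>y. u t0 y) has_real_derivative ux1 t0 y) (at y)" if "\<bar>y - x0\<bar> < - x0" for y
          using D(2)[of y] that by (simp add: abs_if split: if_splits)
      qed (use 1 L1 D[of x0] pde1[OF t0(1)] in auto)
    next
      case 2
      have at: "at y within {0..} = at y" if "y > 0" for y :: real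
        using that by (intro at_within_interior) auto
      have D: "((\<lambda>s. u s y) has_real_derivative ut2 t0 y) (at t0)"
        "((\<lambda>y. u t0 y) has_real_derivative ux2 t0 y) (at y)"
        "(ux2 t0 has_real_derivative uxx2 t0 y) (at y)" if "y > 0" for y
        using C2 that t0(1) at[OF that] unfolding C12_derivs_def by (metis atLeast_iff less_imp_le)+
      show False
      proof (rule no_contact_inside_patch[OF prof2 _ d(2) \<open>\<eta> > 0\<close> B(2) t0(1), where
            sg = "- 1" and r = x0 and u = u and ?x0.0 = x0 and ?l0.0 = l0 and ux = "ux2 t0"])
        show "u t0 x0 < M" using u_less t0(1) by simp
        show "u t0 x0 = V2 (- 1 * x0 + A2 (l0 - e * t0)) + \<eta> * (1 + x0\<^sup>2) * exp (B * t0)"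
          using contact W_right[of x0 t0] 2 by simp
        show "u t x0 \<le> V2 (- 1 * x0 + A2 (l0 - e * t)) + \<eta> * (1 + x0\<^sup>2) * exp (B * t)" if "0 \<le> t" "t < t0" for t
          using before[OF that, of x0] W_right[of x0 t] 2 by simp
        show "u t0 y \<le> V2 (- 1 * y + A2 (l0 - e * t0)) + \<eta> * (1 + y\<^sup>2) * exp (B * t0)" if "\<bar>y - x0\<bar> < x0" for y
          using now[of y] W_right[of y t0] that by (simp add: abs_if split: if_splits)
        show "((\<lambda>y. u t0 y) has_real_derivative ux2 t0 y) (at y)" if "\<bar>y - x0\<bar> < x0" for y
          using D(2)[of y] that by (simp add: abs_if split: if_splits)
      qed (use 2 L2 D[of x0] pde2[OF t0(1)] in auto)
    next
      case 3
      \<comment> \<open>The derivative of \<open>1 + y\<^sup>2\<close> vanishes at the interface, so only the profiles contribute.\<close>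
      define E where "E = exp (B * t0)"
      define a1 where "a1 = A1 (l0 - e * t0)"
      define a2 where "a2 = A2 (l0 - e * t0)"
      have D1: "((\<lambda>y. u t0 y) has_real_derivative ux1 t0 0) (at 0 within {..0})"
        using C1 t0(1) unfolding C12_derivs_def by (metis atMost_iff order_refl)
      have D2: "((\<lambda>y. u t0 y) has_real_derivative ux2 t0 0) (at 0 within {0..})"
        using C2 t0(1) unfolding C12_derivs_def by (metis atLeast_iff order_refl)
      have "((\<lambda>y. V1 (y + a1)) has_real_derivative V1' (0 + a1) * 1) (at 0 within {..0})"
        by (rule DERIV_chain2[OF V1(5)]) (auto intro!: derivative_eq_intros)
      then have "((\<lambda>y. u t0 y - V1 (y + a1) - \<eta> * (1 + y\<^sup>2) * E) has_real_derivative ux1 t0 0 - V1' a1)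
          (at 0 within {..0})"
        by (auto intro!: derivative_eq_intros D1)
      then have "ux1 t0 0 - V1' a1 \<ge> 0"
      proof (rule derivative_nonneg_at_left_max[where a = "- 1"])
        fix y :: real assume "y < 0"
        then show "u t0 y - V1 (y + a1) - \<eta> * (1 + y\<^sup>2) * E \<le> u t0 0 - V1 (0 + a1) - \<eta> * (1 + 0\<^sup>2) * E"
          using now[of y] contact 3 W_left[of y t0] W_left[of 0 t0] by (simp add: a1_def E_def)
      qed simp
      have "((\<lambda>y. V2 (- y + a2)) has_real_derivative V2' (- 0 + a2) * - 1) (at 0 within {0..})"
        by (rule DERIV_chain2[OF V2(5)]) (auto intro!: derivative_eq_intros)
      then have "((\<lambda>y. u t0 y - V2 (- y + a2) - \<eta> * (1 + y\<^sup>2) * E) has_real_derivative ux2 t0 0 + V2' a2)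
          (at 0 within {0..})"
        by (auto intro!: derivative_eq_intros D2)
      then have "ux2 t0 0 + V2' a2 \<le> 0"
      proof (rule derivative_nonpos_at_right_max)
        fix y :: real assume "0 < y"
        then show "u t0 y - V2 (- y + a2) - \<eta> * (1 + y\<^sup>2) * E \<le> u t0 0 - V2 (- 0 + a2) - \<eta> * (1 + 0\<^sup>2) * E"
          using now[of y] contact 3 W_right[of y t0] W_right[of 0 t0] by (simp add: a2_def E_def)
      qed
      then have "\<sigma> * ux2 t0 0 < 0"
        using V2(4)[of a2] d(3) by (intro mult_pos_neg) auto
      then show False
        using \<open>ux1 t0 0 - V1' a1 \<ge> 0\<close> V1(4)[of a1] flux[OF t0(1)] by simp
    qed
  qed
  \<comment> \<open>The point is fixed now, so \<open>\<eta>\<close> may depend on it.\<close>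
  have "u t x \<le> W t x + \<epsilon>" if "\<epsilon> > 0" for \<epsilon>
  proof -
    define w where "w = (1 + x\<^sup>2) * exp (B * t)"
    have "w > 0" by (auto simp: w_def add_pos_nonneg)
    have "u t x < W t x + \<epsilon> / w * (1 + x\<^sup>2) * exp (B * t)"
      using \<open>w > 0\<close> that \<open>t \<ge> 0\<close> by (intro relaxed) simp
    also have "\<epsilon> / w * (1 + x\<^sup>2) * exp (B * t) = \<epsilon> / w * w"
      by (simp only: w_def mult.assoc)
    also have "\<dots> = \<epsilon>" using \<open>w > 0\<close> by simp
    finally show ?thesis by simp
  qed
  then have "u t x \<le> W t x" by (rule field_le_epsilon)
  then show ?thesis by (simp add: W_def)
qed

section \<open>Extinction\<close>

lemma extinction_if_exponentially_bounded:
  assumes cont: "\<And>t. 0 \<le> t \<Longrightarrow> continuous_on UNIV (u t)"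
    and bound: "\<And>t x. 0 \<le> t \<Longrightarrow> \<bar>u t x\<bar> \<le> exp (l - e * t)" and "e > 0"
  shows "extinction u"
  unfolding extinction_def
proof (rule tendsto_sandwich[where f = "\<lambda>_. 0" and h = "\<lambda>t. ereal (exp (l - e * t))"])
  have "((\<lambda>t. exp (l - e * t)) \<longlongrightarrow> 0) at_top"
    using \<open>e > 0\<close> by real_asymp
  then show "((\<lambda>t. ereal (exp (l - e * t))) \<longlongrightarrow> 0) at_top"
    by (metis tendsto_ereal zero_ereal_def)
  have meas: "(\<lambda>x. ereal \<bar>u t x\<bar>) \<in> borel_measurable lborel" if "0 \<le> t" for t
    using borel_measurable_continuous_onI[OF cont[OF that]] by measurable
  show "\<forall>\<^sub>F t in at_top. Linf_norm (\<lambda>x. u t x) \<le> ereal (exp (l - e * t))"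
    using eventually_ge_at_top[of 0]
    by eventually_elim (auto simp: Linf_norm_def bound intro!: esssup_I meas)
  have "0 \<le> Linf_norm (\<lambda>x. u t x)" for t
  proof -
    have "esssup lborel (\<lambda>x :: real. 0 :: ereal) \<le> esssup lborel (\<lambda>x. ereal \<bar>u t x\<bar>)"
      by (rule esssup_mono) auto
    then show ?thesis by (simp add: Linf_norm_def esssup_const)
  qed
  then show "\<forall>\<^sub>F t in at_top. 0 \<le> Linf_norm (\<lambda>x. u t x)" by simp
qed simp

theorem theorem2p14:
  fixes d1 d2 \<sigma> K1 K2 :: real
    and f1 f2 u0 :: "real \<Rightarrow> real"
    and u :: "real \<Rightarrow> real \<Rightarrow> real"
  assumes "d1 > 0" and "d2 > 0" and "\<sigma> > 0" and "K1 > 0" and "K2 > 0"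
    and "f1 C1_differentiable_on UNIV" and "f2 C1_differentiable_on UNIV"
    and "\<exists>\<theta>1. bistable f1 \<theta>1 K1" and "\<exists>\<theta>2. bistable f2 \<theta>2 K2"
    and "integral {0..K1} f1 < 0" and "integral {0..K2} f2 < 0"
    and "continuous_on UNIV u0" and "\<forall>x. 0 \<le> u0 x" and "compact (closure {x. u0 x \<noteq> 0})"
    and "nonneg_bounded_classical_solution d1 d2 \<sigma> f1 f2 u0 u"
  shows "extinction u"
proof -
  have sol: "classical_solution d1 d2 \<sigma> f1 f2 u0 u"
    and nonneg: "\<And>t x. 0 \<le> t \<Longrightarrow> 0 \<le> u t x"
    using assms(15) unfolding nonneg_bounded_classical_solution_def by blast+
  obtain M0 where M0: "\<And>t x. 0 \<le> t \<Longrightarrow> \<bar>u t x\<bar> \<le> M0"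
    using assms(15) unfolding nonneg_bounded_classical_solution_def by blast
  \<comment> \<open>The gap between \<open>M0\<close> and \<open>M\<close> keeps every contact in the range where the profiles are twice
    differentiable.\<close>
  define M where "M = M0 + 1"
  have u_less: "u t x < M" if "0 \<le> t" for t x
    using M0[OF that, of x] by (simp add: M_def)
  have "M > 0"
    using u_less[of 0 0] nonneg[of 0 0] by simp
  have u_cont: "continuous_on ({0..} \<times> UNIV) (\<lambda>(t, x). u t x)" and u_init: "\<And>x. u 0 x = u0 x"
    using sol unfolding classical_solution_def by blast+
  obtain \<theta>1 \<theta>2 where bi: "bistable f1 \<theta>1 K1" "bistable f2 \<theta>2 K2" using assms(8,9) by blast
  obtain e1 V1 V1' V1'' A1 A1' where "e1 > 0"
    and 1: "\<And>e. 0 \<le> e \<Longrightarrow> e \<le> e1 \<Longrightarrow> retreating_profile d1 f1 M e V1 V1' V1'' A1 A1'"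
    using bistable_retreating_profile[OF assms(6) bi(1) assms(10,1) \<open>M > 0\<close>] by metis
  obtain e2 V2 V2' V2'' A2 A2' where "e2 > 0"
    and 2: "\<And>e. 0 \<le> e \<Longrightarrow> e \<le> e2 \<Longrightarrow> retreating_profile d2 f2 M e V2 V2' V2'' A2 A2'"
    using bistable_retreating_profile[OF assms(7) bi(2) assms(11,2) \<open>M > 0\<close>] by metis
  define e where "e = min e1 e2"
  have "e > 0" using \<open>e1 > 0\<close> \<open>e2 > 0\<close> by (simp add: e_def)
  have prof1: "retreating_profile d1 f1 M e V1 V1' V1'' A1 A1'"
    and prof2: "retreating_profile d2 f2 M e V2 V2' V2'' A2 A2'"
    using 1[of e] 2[of e] \<open>e > 0\<close> by (auto simp: e_def)
  obtain R where "\<And>x. x \<in> closure {x. u0 x \<noteq> 0} \<Longrightarrow> \<bar>x\<bar> \<le> R"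
    using compact_imp_bounded[OF assms(14)] unfolding bounded_iff real_norm_def by blast
  then have R: "\<bar>x\<bar> \<le> R" if "u0 x \<noteq> 0" for x
    using closure_subset[of "{x. u0 x \<noteq> 0}"] that by blast
  obtain l1 where l1: "\<And>l' s. l1 \<le> l' \<Longrightarrow> \<bar>s\<bar> \<le> R \<Longrightarrow> M \<le> V1 (s + A1 l')"
    using retreating_profile_large[OF prof1 \<open>M > 0\<close>] by blast
  obtain l2 where l2: "\<And>l' s. l2 \<le> l' \<Longrightarrow> \<bar>s\<bar> \<le> R \<Longrightarrow> M \<le> V2 (s + A2 l')"
    using retreating_profile_large[OF prof2 \<open>M > 0\<close>] by blast
  define l0 where "l0 = max l1 l2"
  have V1: "mono V1" "\<And>l. V1 (A1 l) = exp l" "\<And>s. V1 s > 0"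
    using prof1 unfolding retreating_profile_def by blast+
  have V2: "mono V2" "\<And>l. V2 (A2 l) = exp l" "\<And>s. V2 s > 0"
    using prof2 unfolding retreating_profile_def by blast+
  have init: "u0 x \<le> min (V1 (x + A1 l0)) (V2 (- x + A2 l0))" for x
  proof (cases "u0 x = 0")
    case True
    then show ?thesis using V1(3) V2(3) by (simp add: less_imp_le)
  next
    case False
    then have "u0 x < M" "\<bar>x\<bar> \<le> R" using u_less[of 0 x] u_init R by auto
    then show ?thesis
      using l1[of l0 x] l2[of l0 "- x"] by (simp add: l0_def)
  qed
  have peak: "u t x \<le> exp (l0 - e * t)" if "0 \<le> t" for t x
  proof -
    have "u t x \<le> min (V1 (x + A1 (l0 - e * t))) (V2 (- x + A2 (l0 - e * t)))"
      by (rule classical_solution_below_barrier[OF assms(1-3,6,7) sol u_less prof1 prof2 init that])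
    also have "\<dots> \<le> exp (l0 - e * t)"
    proof (cases "x \<le> 0")
      case True
      then show ?thesis
        using monoD[OF V1(1), of "x + A1 (l0 - e * t)" "A1 (l0 - e * t)"] V1(2) by (simp add: min.coboundedI1)
    next
      case False
      then show ?thesis
        using monoD[OF V2(1), of "- x + A2 (l0 - e * t)" "A2 (l0 - e * t)"] V2(2) by (simp add: min.coboundedI2)
    qed
    finally show ?thesis .
  qed
  show ?thesis
  proof (rule extinction_if_exponentially_bounded[OF _ _ \<open>e > 0\<close>])
    fix t :: real assume "0 \<le> t"
    show "\<bar>u t x\<bar> \<le> exp (l0 - e * t)" for x
      using nonneg[OF \<open>0 \<le> t\<close>, of x] peak[OF \<open>0 \<le> t\<close>, of x] by simp
    have "continuous_on UNIV (\<lambda>x. (\<lambda>(t, x). u t x) (t, x))"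
      by (rule continuous_on_compose2[OF u_cont]) (use \<open>0 \<le> t\<close> in \<open>auto intro!: continuous_intros\<close>)
    then show "continuous_on UNIV (u t)" by simp
  qed
qed

end
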